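(* Let $X$ be a compact metric space, let $A_1, A_2 \subset C(X)$ be closed subalgebras containing the constant functions, and let $f \in C(X)$. Suppose $\{x_1, x_2, \dots\}$ is a closed bolt or an infinite bolt with respect to $A_1$ and $A_2$, and $u \in A_1 + A_2$ is a function such that $$f(x_i) - u(x_i) = (-1)^i\,|f(x_i) - u(x_i)| \quad \text{for } i = 1, 2, \dots$$ (for all indices $i$ of the bolt). Then $$E(f) \ge \inf_i |f(x_i) - u(x_i)|,$$ where the infimum is over all indices $i$ of the bolt.
   Context: $C(X)$ is the space of real-valued continuous functions on $X$ with the max-norm $\|\cdot\|$; closedness of subalgebras is with respect to this norm. $A_1 + A_2 = \{u_1 + u_2 : u_1 \in A_1,\ u_2 \in A_2\}$. The approximation error is $E(f) = \inf_{u \in A_1 + A_2} \|f - u\|$. For $i=1,2$ define the equivalence relation $R_i$ on $X$ by: $a \overset{R_i}{\sim} b$ if $g(a) = g(b)$ for all $g \in A_i$. Let $X_i = X/R_i$ be the quotient spaces, and let $s : X \to X_1$ and $p : X \to X_2$ be the natural projections. Thus $s(a) = s(b)$ iff $g(a)=g(b)$ for all $g \in A_1$, and $p(a) = p(b)$ iff $g(a)=g(b)$ for all $g \in A_2$. A bolt (lightning bolt with respect to $A_1$ and $A_2$) is a finite or infinite ordered sequence $\{x_1, x_2, \dots\}$ of points of $X$ (points may repeat), with $x_i \ne x_{i+1}$ for all $i$, such that either $s(x_1) = s(x_2),\ p(x_2) = p(x_3),\ s(x_3) = s(x_4), \dots$ or $p(x_1) = p(x_2),\ s(x_2) = s(x_3),\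 p(x_3) = p(x_4), \dots$. If $\{x_1, \dots, x_n, x_{n+1}\}$ is a finite bolt with $x_{n+1} = x_1$ and $n$ even, then $\{x_1, \dots, x_n\}$ is called a closed bolt. *)

theory Defs
  imports "HOL-Analysis.Analysis" "HOL-Library.Extended_Nat"
begin

text \<open>
  On a compact space every continuous function is bounded, so
  \<^typ>\<open>'a \<Rightarrow>\<^sub>C real\<close> with its norm is $C(X)$ with the max-norm whenever
  \<^term>\<open>UNIV :: 'a set\<close> is compact. The library has no product on this type, whence
  \<^term>\<open>Bcontfun\<close> below; pointwise products of bounded continuous functions are again
  bounded and continuous, so no junk values of \<^term>\<open>Bcontfun\<close> arise.
\<close>

definition subalgebra :: "('a::topological_space \<Rightarrow>\<^sub>C real) set \<Rightarrow> bool" where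
  "subalgebra A \<longleftrightarrow>
     subspace A \<and>
     (\<forall>g\<in>A. \<forall>h\<in>A. Bcontfun (\<lambda>x. apply_bcontfun g x * apply_bcontfun h x) \<in> A)"

lemma mult_in_bcontfun:
  fixes g h :: "'a::topological_space \<Rightarrow>\<^sub>C real"
  shows "(\<lambda>x. apply_bcontfun g x * apply_bcontfun h x) \<in> bcontfun"
proof (rule bcontfun_normI)
  show "continuous_on UNIV (\<lambda>x. apply_bcontfun g x * apply_bcontfun h x)"
    by (intro continuous_intros) auto
  fix x
  show "norm (apply_bcontfun g x * apply_bcontfun h x) \<le> norm g * norm h"
    unfolding norm_mult by (intro mult_mono norm_bounded) auto
qed

definition contains_constants :: "('a::topological_space \<Rightarrow>\<^sub>C real) set \<Rightarrow> bool" where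
  "contains_constants A \<longleftrightarrow> (\<forall>c. const_bcontfun c \<in> A)"

definition approx_error ::
  "('a::topological_space \<Rightarrow>\<^sub>C real) set \<Rightarrow> ('a \<Rightarrow>\<^sub>C real) set \<Rightarrow> ('a \<Rightarrow>\<^sub>C real) \<Rightarrow> real" where
  "approx_error A1 A2 f = (INF u\<in>A1 + A2. norm (f - u))"

definition alg_rel :: "('a::topological_space \<Rightarrow>\<^sub>C real) set \<Rightarrow> ('a \<times> 'a) set" where
  "alg_rel A = {(a, b). \<forall>g\<in>A. apply_bcontfun g a = apply_bcontfun g b}"

lemma equiv_alg_rel: "equiv UNIV (alg_rel A)"
  by (auto simp: alg_rel_def equiv_def refl_on_def sym_def trans_def)

text \<open>The natural projection of $X$ onto the quotient \<^term>\<open>UNIV // alg_rel A\<close>.\<close>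

definition quot_proj :: "('a::topological_space \<Rightarrow>\<^sub>C real) set \<Rightarrow> 'a \<Rightarrow> 'a set" where
  "quot_proj A = Equiv_Relations.proj (alg_rel A)"

lemma quot_proj_eq_iff:
  "quot_proj A a = quot_proj A b \<longleftrightarrow> (\<forall>g\<in>A. apply_bcontfun g a = apply_bcontfun g b)"
  using eq_equiv_class_iff[OF equiv_alg_rel, of a b A]
  by (simp add: quot_proj_def Equiv_Relations.proj_def alg_rel_def)

text \<open>
  \<^term>\<open>bolt A1 A2 N x\<close>: the sequence $x_1, x_2, \dots$ with $N \le \infty$ terms is a bolt.
  Indices start at 1; the values of \<^term>\<open>x\<close> at 0 and beyond \<^term>\<open>N\<close> are irrelevant.
\<close>

definition bolt ::
  "('a::topological_space \<Rightarrow>\<^sub>C real) set \<Rightarrow> ('a \<Rightarrow>\<^sub>C real) set \<Rightarrow> enat \<Rightarrow> (nat \<Rightarrow> 'a) \<Rightarrow> bool" where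
  "bolt A1 A2 N x \<longleftrightarrow>
     (let s = quot_proj A1; p = quot_proj A2 in
       (\<forall>i\<ge>1. enat (i + 1) \<le> N \<longrightarrow> x i \<noteq> x (i + 1)) \<and>
       ((\<forall>i\<ge>1. enat (i + 1) \<le> N \<longrightarrow>
           (if odd i then s (x i) = s (x (i + 1)) else p (x i) = p (x (i + 1)))) \<or>
        (\<forall>i\<ge>1. enat (i + 1) \<le> N \<longrightarrow>
           (if odd i then p (x i) = p (x (i + 1)) else s (x i) = s (x (i + 1))))))"

text \<open>
  The points of a closed bolt are $x_1, \dots, x_n$. The degenerate empty sequence
  ($n = 0$) is excluded.
\<close>

definition closed_bolt ::
  "('a::topological_space \<Rightarrow>\<^sub>C real) set \<Rightarrow> ('a \<Rightarrow>\<^sub>C real) set \<Rightarrow> nat \<Rightarrow> (nat \<Rightarrow> 'a) \<Rightarrow> bool" where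
  "closed_bolt A1 A2 n x \<longleftrightarrow>
     0 < n \<and> even n \<and> bolt A1 A2 (enat (n + 1)) x \<and> x (n + 1) = x 1"

end

theory Submission
  imports Defs
begin

text \<open>
  Annihilation along bolts. If \<^term>\<open>w = g + h\<close> with \<^term>\<open>g \<in> A1\<close> and
  \<^term>\<open>h \<in> A2\<close>, then in the alternating sum of \<^term>\<open>w\<close> over the first \<open>2k\<close> points
  of a bolt one of the two summands cancels pair by pair while the other one telescopes, so the
  sum is just a difference of two values of \<^term>\<open>g\<close> or of \<^term>\<open>h\<close>
  (\<open>bolt_alternating_sum\<close>). It therefore vanishes for a closed bolt and stays bounded in
  \<open>k\<close> for an infinite one.

  Let \<open>m\<close> be the infimum of \<open>\<bar>f - u\<bar>\<close> on the bolt, and let \<open>v \<in> A1 + A2\<close>. By the sign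
  condition the alternating sum of \<open>f - u\<close> is at least \<open>2k m\<close>, while that of \<open>f - v\<close> is at
  most \<open>2k \<parallel>f - v\<parallel>\<close>. They differ by the alternating sum of \<open>v - u \<in> A1 + A2\<close>. Dividing by
  \<open>2k\<close>, and letting \<open>k\<close> tend to infinity when the bolt is infinite, gives
  \<open>m \<le> \<parallel>f - v\<parallel>\<close>.
\<close>

lemma alternating_sum_telescope:
  fixes a b :: "nat \<Rightarrow> real"
  assumes "\<And>i. 1 \<le> i \<Longrightarrow> i \<le> 2 * k \<Longrightarrow> odd i \<Longrightarrow> a i = a (i + 1)"
    and "\<And>i. 1 \<le> i \<Longrightarrow> i \<le> 2 * k \<Longrightarrow> even i \<Longrightarrow> b i = b (i + 1)"
  shows "(\<Sum>i=1..2*k. (-1) ^ i * (a i + b i)) = b (2 * k + 1) - b 1"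
  using assms
proof (induction k)
  case 0
  then show ?case by simp
next
  case (Suc k)
  have "(\<Sum>i=1..2*k. (-1) ^ i * (a i + b i)) = b (2 * k + 1) - b 1"
    using Suc.prems by (intro Suc.IH) auto
  moreover have "a (2 * k + 1) = a (2 * k + 2)"
    using Suc.prems(1)[of "2 * k + 1"] by simp
  moreover have "b (2 * k + 2) = b (2 * k + 3)"
    using Suc.prems(2)[of "2 * k + 2"] by (simp add: numeral_3_eq_3)
  ultimately show ?case
    by (simp add: numeral_3_eq_3)
qed

text \<open>
  The function \<^term>\<open>q\<close> is the summand of \<^term>\<open>w\<close> that telescopes; which of the two it
  is depends on the projection with which the bolt starts. The sum runs over \<open>2k\<close> points, but
  the bolt must reach one point further for the last link to be available.
\<close>

lemma bolt_alternating_sum: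
  assumes "bolt A1 A2 N x" and "w \<in> A1 + A2"
  obtains q :: "'a::topological_space \<Rightarrow>\<^sub>C real" where
    "\<And>k. enat (2 * k + 1) \<le> N \<Longrightarrow>
      (\<Sum>i=1..2*k. (-1) ^ i * apply_bcontfun w (x i))
        = apply_bcontfun q (x (2 * k + 1)) - apply_bcontfun q (x 1)"
proof -
  obtain g h where w: "w = g + h" and g: "g \<in> A1" and h: "h \<in> A2"
    using assms(2) by (rule set_plus_elim)
  have reach: "enat (i + 1) \<le> N" if "enat (2 * k + 1) \<le> N" "i \<le> 2 * k" for i k
    using that by (meson add_right_mono enat_ord_simps(1) order_trans)
  consider
      (s) "\<And>i. 1 \<le> i \<Longrightarrow> enat (i + 1) \<le> N \<Longrightarrow>
        (if odd i then quot_proj A1 (x i) = quot_proj A1 (x (i + 1))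
         else quot_proj A2 (x i) = quot_proj A2 (x (i + 1)))"
    | (p) "\<And>i. 1 \<le> i \<Longrightarrow> enat (i + 1) \<le> N \<Longrightarrow>
        (if odd i then quot_proj A2 (x i) = quot_proj A2 (x (i + 1))
         else quot_proj A1 (x i) = quot_proj A1 (x (i + 1)))"
    using assms(1) unfolding bolt_def Let_def by blast
  then show thesis
  proof cases
    case s
    show thesis
    proof (rule that[of h])
      fix k assume k: "enat (2 * k + 1) \<le> N"
      show "(\<Sum>i=1..2*k. (-1) ^ i * apply_bcontfun w (x i))
          = apply_bcontfun h (x (2 * k + 1)) - apply_bcontfun h (x 1)"
        unfolding w plus_bcontfun.rep_eq
      proof (rule alternating_sum_telescope)
        fix i assume i: "1 \<le> i" "i \<le> 2 * k"
        note link = s[OF i(1) reach[OF k i(2)], unfolded quot_proj_eq_iff]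
        show "apply_bcontfun g (x i) = apply_bcontfun g (x (i + 1))" if "odd i"
          using link that g by auto
        show "apply_bcontfun h (x i) = apply_bcontfun h (x (i + 1))" if "even i"
          using link that h by auto
      qed
    qed
  next
    case p
    show thesis
    proof (rule that[of g])
      fix k assume k: "enat (2 * k + 1) \<le> N"
      have w': "w = h + g" by (simp add: w add.commute)
      show "(\<Sum>i=1..2*k. (-1) ^ i * apply_bcontfun w (x i))
          = apply_bcontfun g (x (2 * k + 1)) - apply_bcontfun g (x 1)"
        unfolding w' plus_bcontfun.rep_eq
      proof (rule alternating_sum_telescope)
        fix i assume i: "1 \<le> i" "i \<le> 2 * k"
        note link = p[OF i(1) reach[OF k i(2)], unfolded quot_proj_eq_iff]
        show "apply_bcontfun h (x i) = apply_bcontfun h (x (i + 1))" if "odd i"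
          using link that h by auto
        show "apply_bcontfun g (x i) = apply_bcontfun g (x (i + 1))" if "even i"
          using link that g by auto
      qed
    qed
  qed
qed

lemma subspace_set_plus_diff:
  assumes "subspace A" "subspace B" "v \<in> A + B" "u \<in> A + B"
  shows "v - u \<in> A + B"
proof -
  obtain a b c d where "v = a + b" "u = c + d" "a \<in> A" "c \<in> A" "b \<in> B" "d \<in> B"
    using assms(3,4) by (auto elim!: set_plus_elim)
  moreover from this have "v - u = (a - c) + (b - d)" by simp
  ultimately show ?thesis
    using assms(1,2) by (metis set_plus_intro subspace_diff)
qed

text \<open>
  Comparison of the alternating sums of \<^term>\<open>f - u\<close> and \<^term>\<open>f - v\<close> over the same
  \<open>2k\<close> points.
\<close>

lemma alternating_lower_bound:
  fixes f u v :: "'a::topological_space \<Rightarrow>\<^sub>C real" and x :: "nat \<Rightarrow> 'a"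
  assumes sign: "\<And>i. i \<in> {1..2*k} \<Longrightarrow> apply_bcontfun f (x i) - apply_bcontfun u (x i)
      = (-1) ^ i * \<bar>apply_bcontfun f (x i) - apply_bcontfun u (x i)\<bar>"
    and m: "\<And>i. i \<in> {1..2*k} \<Longrightarrow> m \<le> \<bar>apply_bcontfun f (x i) - apply_bcontfun u (x i)\<bar>"
  shows "2 * real k * (m - norm (f - v)) \<le> (\<Sum>i=1..2*k. (-1) ^ i * apply_bcontfun (v - u) (x i))"
proof -
  have "m - norm (f - v) \<le> (-1) ^ i * apply_bcontfun (v - u) (x i)" if i: "i \<in> {1..2*k}" for i
  proof -
    have "\<bar>apply_bcontfun f (x i) - apply_bcontfun v (x i)\<bar> \<le> norm (f - v)"
      using norm_bounded[of "f - v" "x i"] by (simp add: minus_bcontfun.rep_eq)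
    then show ?thesis
      using sign[OF i] m[OF i] by (cases "even i") (auto simp: minus_bcontfun.rep_eq)
  qed
  then have "(\<Sum>i=1..2*k. m - norm (f - v))
      \<le> (\<Sum>i=1..2*k. (-1) ^ i * apply_bcontfun (v - u) (x i))"
    by (rule sum_mono)
  then show ?thesis by simp
qed

theorem theorem2p2:
  fixes A1 A2 :: "('a::metric_space \<Rightarrow>\<^sub>C real) set"
    and f u :: "'a \<Rightarrow>\<^sub>C real"
    and x :: "nat \<Rightarrow> 'a"
    and I :: "nat set"
  assumes "compact (UNIV :: 'a set)"
    and "subalgebra A1" and "closed A1" and "contains_constants A1"
    and "subalgebra A2" and "closed A2" and "contains_constants A2"
    and "(\<exists>n. closed_bolt A1 A2 n x \<and> I = {1..n}) \<or> (bolt A1 A2 \<infinity> x \<and> I = {1..})"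
    and "u \<in> A1 + A2"
    and "\<forall>i\<in>I. apply_bcontfun f (x i) - apply_bcontfun u (x i)
               = (-1) ^ i * \<bar>apply_bcontfun f (x i) - apply_bcontfun u (x i)\<bar>"
  shows "approx_error A1 A2 f
         \<ge> (INF i\<in>I. \<bar>apply_bcontfun f (x i) - apply_bcontfun u (x i)\<bar>)"
proof -
  define m where "m = (INF i\<in>I. \<bar>apply_bcontfun f (x i) - apply_bcontfun u (x i)\<bar>)"
  have m: "m \<le> \<bar>apply_bcontfun f (x i) - apply_bcontfun u (x i)\<bar>" if "i \<in> I" for i
    unfolding m_def using that by (intro cINF_lower bdd_belowI2[of _ 0]) auto
  have "m \<le> norm (f - v)" if v: "v \<in> A1 + A2" for v
  proof -
    have vu: "v - u \<in> A1 + A2"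
      using assms(2,5,9) v by (auto simp: subalgebra_def intro: subspace_set_plus_diff)
    have bound: "2 * real k * (m - norm (f - v))
        \<le> (\<Sum>i=1..2*k. (-1) ^ i * apply_bcontfun (v - u) (x i))" if "{1..2*k} \<subseteq> I" for k
      using assms(10) m that by (intro alternating_lower_bound) blast+
    show ?thesis
      using assms(8)
    proof (elim disjE exE conjE)
      fix n assume n: "closed_bolt A1 A2 n x" and I: "I = {1..n}"
      then obtain k where k: "n = 2 * k" "0 < k"
        by (auto simp: closed_bolt_def elim: evenE)
      obtain q where "\<And>k. enat (2 * k + 1) \<le> enat (n + 1) \<Longrightarrow>
          (\<Sum>i=1..2*k. (-1) ^ i * apply_bcontfun (v - u) (x i))
            = apply_bcontfun q (x (2 * k + 1)) - apply_bcontfun q (x 1)"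
        using n vu by (auto simp only: closed_bolt_def elim: bolt_alternating_sum)
      from this[of k] have "(\<Sum>i=1..2*k. (-1) ^ i * apply_bcontfun (v - u) (x i)) = 0"
        using n k by (simp add: closed_bolt_def)
      with bound[of k] I k have "2 * real k * (m - norm (f - v)) \<le> 0" by simp
      with k show ?thesis by (simp add: mult_le_0_iff)
    next
      assume b: "bolt A1 A2 \<infinity> x" and I: "I = {1..}"
      obtain q where q: "\<And>k. enat (2 * k + 1) \<le> \<infinity> \<Longrightarrow>
          (\<Sum>i=1..2*k. (-1) ^ i * apply_bcontfun (v - u) (x i))
            = apply_bcontfun q (x (2 * k + 1)) - apply_bcontfun q (x 1)"
        using bolt_alternating_sum[OF b vu] by blast
      have le: "real k * (m - norm (f - v)) \<le> norm q" for k
        using bound[of k] q[of k] I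
          norm_bounded[of q "x (2 * k + 1)"] norm_bounded[of q "x 1"] by force
      show ?thesis
      proof (rule ccontr)
        assume "\<not> m \<le> norm (f - v)"
        then obtain k where "norm q < real k * (m - norm (f - v))"
          using reals_Archimedean3[of "m - norm (f - v)"] by auto
        with le[of k] show False by simp
      qed
    qed
  qed
  then show ?thesis
    unfolding approx_error_def m_def[symmetric] using assms(9) by (intro cINF_greatest) auto
qed

end
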